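(* For all $k\geq 3$, $$\mathcal{D}_{23\dots k1}(x)=1+x+\frac{x^2(1+x)}{1-x^2-x^2F_{k-3}(x)}.$$
   Context: A permutation $\pi$ is a Dumont permutation (of the first kind) if each even integer in $\pi$ is followed by a smaller integer, and each odd integer is either followed by a larger integer or is the last element of $\pi$. For a pattern $\tau$, $\mathcal{D}_\tau(x)=\sum_{n\geq0}\mathcal{D}_\tau(n)x^n$ where $\mathcal{D}_\tau(n)$ is the number of Dumont permutations of length $n$ avoiding both $132$ and $\tau$ (classical patterns). For $r\geq2$ consider $Q_r(x)=1+\frac{x^2Q_{r-1}(x)}{1-x^2Q_{r-2}(x)}$; $F_r(x)$ is its solution with $Q_0(x)=0$, $Q_1(x)=1$. *)

theory Defs
  imports
    "HOL-Computational_Algebra.Formal_Power_Series"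
    "HOL-Combinatorics.Multiset_Permutations"
    "HOL-Library.Sublist"
begin

text \<open>
  Permutations of length \<open>n\<close> are written in one-line notation, i.e. as the lists in
  \<^term>\<open>permutations_of_set {1..n}\<close>; for \<open>n = 0\<close> this is the empty permutation only.
\<close>

definition dumont :: "nat list \<Rightarrow> bool" where
  "dumont p \<longleftrightarrow> (\<forall>i < length p.
     (even (p ! i) \<longrightarrow> Suc i < length p \<and> p ! Suc i < p ! i) \<and>
     (odd (p ! i) \<longrightarrow> Suc i = length p \<or> p ! i < p ! Suc i))"

definition order_isomorphic :: "nat list \<Rightarrow> nat list \<Rightarrow> bool" where
  "order_isomorphic xs ys \<longleftrightarrow> length xs = length ys \<and>
     (\<forall>i < length xs. \<forall>j < length xs. xs ! i < xs ! j \<longleftrightarrow> ys ! i < ys ! j)"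

definition avoids :: "nat list \<Rightarrow> nat list \<Rightarrow> bool" where
  "avoids p t \<longleftrightarrow> \<not> (\<exists>xs. subseq xs p \<and> order_isomorphic xs t)"

definition dumont_count :: "nat list \<Rightarrow> nat \<Rightarrow> nat" where
  "dumont_count t n =
     card {p \<in> permutations_of_set {1..n}. dumont p \<and> avoids p [1, 3, 2] \<and> avoids p t}"

definition dumont_gf :: "nat list \<Rightarrow> rat fps" where
  "dumont_gf t = Abs_fps (\<lambda>n. of_nat (dumont_count t n))"

text \<open>
  Every denominator below has constant coefficient \<open>1\<close>, so the division of formal power
  series is multiplication by a genuine inverse.
\<close>

fun F :: "nat \<Rightarrow> rat fps" where
  "F 0 = 0"
| "F (Suc 0) = 1"
| "F (Suc (Suc r)) = 1 + fps_X\<^sup>2 * F (Suc r) / (1 - fps_X\<^sup>2 * F r)"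

end

theory Submission
  imports Defs "HOL-Computational_Algebra.Formal_Laurent_Series"
begin

text \<open>
  In a Dumont permutation of odd length the largest entry comes last, and deleting it is a
  bijection onto the Dumont permutations of the next smaller, even length; so it suffices to
  count in even length. Let \<open>2m + 2\<close> be the largest entry of \<open>p = L (2m + 2) R\<close>. Avoiding 132 means
  that all of \<open>L\<close> lies above all of \<open>R\<close>. If \<open>R\<close> has odd length, the least entry of \<open>L\<close> would be
  even and hence followed by a smaller entry, so \<open>L\<close> is empty and \<open>R\<close> ends in \<open>2m + 1\<close>. If \<open>R\<close> has
  even length, \<open>L\<close> is a shifted Dumont permutation of odd length and ends in \<open>2m + 1\<close>. Thus either
  \<open>p = (2m + 2) q (2m + 1)\<close> or \<open>p = l (2m + 1) (2m + 2) r\<close> with \<open>r\<close> nonempty. Writing \<open>lis\<close> for the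
  length of a longest increasing subsequence, it equals \<open>lis q + 1\<close> and \<open>max (lis l + 2) (lis r)\<close>
  respectively, so \<open>F j\<close> counts the permutations of even length with \<open>lis < j\<close>. The pattern
  \<open>23\<dots>k1\<close> occurs in the first form iff it occurs in \<open>q\<close>, and in the second iff it occurs
  in \<open>r\<close> or \<open>lis l \<ge> k - 3\<close>.
\<close>

subsection \<open>Patterns in direct and skew sums\<close>

text \<open>Encodes \<open>lis p >= j\<close> as a threshold, so that a maximum over parts of a
  permutation turns into a disjunction.\<close>

definition has_inc :: "nat \<Rightarrow> nat list \<Rightarrow> bool" where
  "has_inc j p \<longleftrightarrow> (\<exists>xs. subseq xs p \<and> length xs = j \<and> sorted_wrt (<) xs)"

text \<open>Occurrence of \<open>23...k1\<close> for \<open>k = j + 1\<close>, free of order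
  isomorphisms so that it can be split along \<open>@\<close>.\<close>

definition has_inc_drop :: "nat \<Rightarrow> nat list \<Rightarrow> bool" where
  "has_inc_drop j p \<longleftrightarrow>
     (\<exists>xs y. subseq (xs @ [y]) p \<and> length xs = j \<and> sorted_wrt (<) xs \<and> (\<forall>x\<in>set xs. y < x))"

section \<open>The two patterns in terms of subsequences\<close>

lemma order_isomorphic_132_iff:
  "order_isomorphic xs [1, 3, 2] \<longleftrightarrow> (\<exists>a b c. xs = [a, c, b] \<and> a < b \<and> b < c)"
proof
  assume *: "order_isomorphic xs [1, 3, 2]"
  then have "length xs = 3"
    by (simp add: order_isomorphic_def)
  then obtain a c b where "xs = [a, c, b]"
    by (auto simp: length_Suc_conv numeral_eq_Suc)
  with * show "\<exists>a b c. xs = [a, c, b] \<and> a < b \<and> b < c"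
    by (auto simp: order_isomorphic_def All_less_Suc numeral_eq_Suc)
next
  assume "\<exists>a b c. xs = [a, c, b] \<and> a < b \<and> b < c"
  then show "order_isomorphic xs [1, 3, 2]"
    by (auto simp: order_isomorphic_def less_Suc_eq numeral_eq_Suc)
qed

lemma avoids_132_iff:
  "avoids p [1, 3, 2] \<longleftrightarrow> (\<forall>a b c. subseq [a, c, b] p \<longrightarrow> a < b \<longrightarrow> \<not> b < c)"
  unfolding avoids_def order_isomorphic_132_iff by blast

text \<open>The block \<open>[2..<k + 1]\<close> is increasing of length \<open>k - 1\<close> and
  lies above the final 1; only these comparisons matter.\<close>

lemma order_isomorphic_upt_1_iff:
  assumes "k \<ge> 1"
  shows "order_isomorphic xs ([2..<k + 1] @ [1]) \<longleftrightarrow>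
    (\<exists>zs y. xs = zs @ [y] \<and> length zs = k - 1 \<and> sorted_wrt (<) zs \<and> (\<forall>z\<in>set zs. y < z))"
    (is "_ \<longleftrightarrow> ?R")
proof
  let ?t = "[2..<k + 1] @ [1::nat]"
  have nth: "?t ! i = (if i < k - 1 then i + 2 else 1)" if "i < k" for i
    using that assms by (cases "k = 1") (auto simp: nth_append)
  assume *: "order_isomorphic xs ?t"
  then have len: "length xs = k" using assms
    by (auto simp: order_isomorphic_def)
  from * have cmp: "xs ! i < xs ! j \<longleftrightarrow> ?t ! i < ?t ! j" if "i < k" "j < k" for i j
    using that len unfolding order_isomorphic_def by blast
  from len assms have "xs \<noteq> []" by auto
  then obtain zs y where xs: "xs = zs @ [y]"
    by (metis rev_exhaust)
  with len have lz: "length zs = k - 1" by auto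
  have "zs ! i < zs ! j" if "i < j" "j < k - 1" for i j
    using cmp[of i j] that by (auto simp: nth xs nth_append lz)
  then have "sorted_wrt (<) zs"
    by (auto simp: sorted_wrt_iff_nth_less lz)
  moreover have "y < zs ! i" if "i < k - 1" for i
    using cmp[of "k - 1" i] that by (auto simp: nth xs nth_append lz)
  then have "\<forall>z\<in>set zs. y < z"
    by (auto simp: in_set_conv_nth lz)
  ultimately show ?R
    using xs lz by blast
next
  let ?t = "[2..<k + 1] @ [1::nat]"
  have nth: "?t ! i = (if i < k - 1 then i + 2 else 1)" if "i < k" for i
    using that assms by (cases "k = 1") (auto simp: nth_append)
  assume ?R
  then obtain zs y where xs: "xs = zs @ [y]" and lz: "length zs = k - 1"
    and s: "sorted_wrt (<) zs" and y: "\<forall>z\<in>set zs. y < z" by blast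
  have len: "length xs = k" using xs lz assms by auto
  have s1: "zs ! i < zs ! j" if "i < j" "j < k - 1" for i j
    using s that lz by (auto simp: sorted_wrt_iff_nth_less)
  \<comment> \<open>Order isomorphism needs both directions; the converse comes from comparing the
    indices.\<close>
  have s2: "zs ! i < zs ! j \<longleftrightarrow> i < j" if "i < k - 1" "j < k - 1" for i j
    using s1[of i j] s1[of j i] that by (metis less_asym' linorder_neqE_nat)
  have y1: "y < zs ! i" if "i < k - 1" for i
    using y that lz by auto
  have xn: "xs ! i = (if i < k - 1 then zs ! i else y)" if "i < k" for i
    using that by (auto simp: xs nth_append lz)
  have "xs ! i < xs ! j \<longleftrightarrow> ?t ! i < ?t ! j" if "i < k" "j < k" for i j
    unfolding nth[OF that(1)] nth[OF that(2)] xn[OF that(1)] xn[OF that(2)]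
    using s2 y1[of i] y1[of j] that by auto
  then show "order_isomorphic xs ?t"
    unfolding order_isomorphic_def using len assms by auto
qed

lemma avoids_upt_1_iff:
  assumes "k \<ge> 1"
  shows "avoids p ([2..<k + 1] @ [1]) \<longleftrightarrow> \<not> has_inc_drop (k - 1) p"
  unfolding avoids_def has_inc_drop_def order_isomorphic_upt_1_iff[OF assms] by blast

text \<open>The same index sets select subsequences before and after mapping, and \<open>f\<close>
  keeps all comparisons. Needed for the upward shift of \<open>l\<close>.\<close>

lemma avoids_map_strict_mono:
  assumes "strict_mono f"
  shows "avoids (map f p) t \<longleftrightarrow> avoids p t"
proof -
  have "order_isomorphic (map f xs) t \<longleftrightarrow> order_isomorphic xs t" for xs
    using strict_mono_less[OF assms] by (auto simp: order_isomorphic_def)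
  then show ?thesis
    unfolding avoids_def subseq_conv_nths by (metis nths_map)
qed

lemma has_inc_map_strict_mono:
  fixes f :: "nat \<Rightarrow> nat"
  assumes "strict_mono f"
  shows "has_inc j (map f p) \<longleftrightarrow> has_inc j p"
proof -
  have "sorted_wrt (<) (map f xs) \<longleftrightarrow> sorted_wrt (<) xs" for xs
    using strict_mono_less[OF assms] by (simp add: sorted_wrt_map)
  then show ?thesis
    unfolding has_inc_def subseq_conv_nths by (metis length_map nths_map)
qed

section \<open>Increasing subsequences, with or without a final drop\<close>

lemma subseq_set_subset: "subseq xs ys \<Longrightarrow> set xs \<subseteq> set ys"
  by (metis notin_set_nthsI subseq_conv_nths subsetI)

lemma has_inc_0 [simp]: "has_inc 0 p"
  unfolding has_inc_def by (metis length_0_conv list_emb_Nil sorted_wrt.simps(1))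

lemma has_inc_mono: "has_inc j p \<Longrightarrow> i \<le> j \<Longrightarrow> has_inc i p"
  unfolding has_inc_def
  by (metis length_take min.absorb2 sorted_wrt_take take_is_prefix prefix_imp_subseq
      subseq_order.trans)

lemma has_inc_imp_le_length: "has_inc j p \<Longrightarrow> j \<le> length p"
  unfolding has_inc_def using list_emb_length by blast

lemma has_inc_drop_imp_has_inc: "has_inc_drop j p \<Longrightarrow> has_inc j p"
proof -
  assume "has_inc_drop j p"
  then obtain xs y where xs: "subseq (xs @ [y]) p" "length xs = j" "sorted_wrt (<) xs"
    unfolding has_inc_drop_def by blast
  have "subseq xs (xs @ [y])" by auto
  then have "subseq xs p" using xs(1) by (rule subseq_order.trans)
  with xs show "has_inc j p" unfolding has_inc_def by blast
qed

text \<open>\<open>M\<close> prolongs every increasing subsequence of \<open>q\<close>, and dropping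
  it costs at most one entry.\<close>

lemma has_inc_snoc_max:
  assumes "\<forall>x\<in>set q. x < M"
  shows "has_inc (Suc j) (q @ [M]) \<longleftrightarrow> has_inc j q"
proof
  assume "has_inc (Suc j) (q @ [M])"
  then obtain xs where xs: "subseq xs (q @ [M])" "length xs = Suc j" "sorted_wrt (<) xs"
    by (auto simp: has_inc_def)
  then obtain ys zs where "xs = ys @ zs" "subseq ys q" "subseq zs [M]"
    by (auto elim: subseq_appendE)
  moreover from this have "length zs \<le> 1"
    using list_emb_length by fastforce
  ultimately have "has_inc (length ys) q" "j \<le> length ys"
    using xs by (auto simp: has_inc_def sorted_wrt_append)
  then show "has_inc j q" by (rule has_inc_mono)
next
  assume "has_inc j q"
  then obtain xs where xs: "subseq xs q" "length xs = j" "sorted_wrt (<) xs"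
    by (auto simp: has_inc_def)
  then have "subseq (xs @ [M]) (q @ [M])" "length (xs @ [M]) = Suc j" "sorted_wrt (<) (xs @ [M])"
    using assms subseq_set_subset by (fastforce simp: sorted_wrt_append)+
  then show "has_inc (Suc j) (q @ [M])"
    unfolding has_inc_def by blast
qed

text \<open>A passage from \<open>xs\<close> to \<open>ys\<close> is a descent, so an increasing
  subsequence stays in one block.\<close>

lemma has_inc_skew_append:
  assumes "\<forall>x\<in>set xs. \<forall>y\<in>set ys. y < x"
  shows "has_inc j (xs @ ys) \<longleftrightarrow> has_inc j xs \<or> has_inc j ys"
proof
  assume "has_inc j (xs @ ys)"
  then obtain us vs where uv: "subseq us xs" "subseq vs ys" "length (us @ vs) = j"
    "sorted_wrt (<) (us @ vs)"
    unfolding has_inc_def by (metis subseq_appendE)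
  have "us = [] \<or> vs = []"
    using uv assms subseq_set_subset[of us xs] subseq_set_subset[of vs ys]
    by (cases us; cases vs; force)
  with uv show "has_inc j xs \<or> has_inc j ys"
    unfolding has_inc_def by auto
next
  assume "has_inc j xs \<or> has_inc j ys"
  then show "has_inc j (xs @ ys)"
    unfolding has_inc_def by blast
qed

text \<open>A final maximum cannot belong to the run, which is followed by \<open>y\<close>, nor be
  \<open>y\<close>, which has a larger entry before it. The latter needs \<open>j > 0\<close>: for
  \<open>j = 0\<close> the entry \<open>M\<close> alone would be an occurrence.\<close>

lemma has_inc_drop_snoc_max:
  assumes "\<forall>x\<in>set q. x < M" "j > 0"
  shows "has_inc_drop j (q @ [M]) \<longleftrightarrow> has_inc_drop j q"
proof
  assume "has_inc_drop j (q @ [M])"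
  then obtain xs y where xs: "subseq (xs @ [y]) (q @ [M])" "length xs = j" "sorted_wrt (<) xs"
    "\<forall>x\<in>set xs. y < x"
    by (auto simp: has_inc_drop_def)
  have "y \<noteq> M"
  proof
    assume "y = M"
    moreover from this xs have "subseq xs q" by simp
    moreover have "xs \<noteq> []" using xs assms by auto
    ultimately show False
      using xs assms subseq_set_subset[of xs q] by (cases xs) auto
  qed
  have "subseq (xs @ [y]) q"
  proof -
    obtain us vs where uv: "xs @ [y] = us @ vs" "subseq us q" "subseq vs [M]"
      using xs(1) by (auto elim: subseq_appendE)
    \<comment> \<open>A nonempty part inside \<open>[M]\<close> would end in \<open>y\<close> and
      force \<open>y = M\<close>.\<close>
    have "vs = []"
    proof (rule ccontr)
      assume "vs \<noteq> []"
      then have "last vs = y" using uv(1) by (metis last_append last_snoc)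
      then have "y \<in> set [M]" using \<open>vs \<noteq> []\<close> subseq_set_subset[OF uv(3)] by (metis last_in_set subsetD)
      with \<open>y \<noteq> M\<close> show False by simp
    qed
    with uv show ?thesis by simp
  qed
  with xs show "has_inc_drop j q"
    unfolding has_inc_drop_def by blast
next
  assume "has_inc_drop j q"
  then show "has_inc_drop j (q @ [M])"
    unfolding has_inc_drop_def by blast
qed

text \<open>The run lies in one block. If it lies in \<open>xs\<close>, any entry of
  \<open>ys\<close> serves as the drop, so only its length counts.\<close>

lemma has_inc_drop_skew_append:
  assumes "\<forall>x\<in>set xs. \<forall>y\<in>set ys. y < x" "ys \<noteq> []"
  shows "has_inc_drop j (xs @ ys) \<longleftrightarrow> has_inc j xs \<or> has_inc_drop j ys"
proof
  assume "has_inc_drop j (xs @ ys)"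
  then obtain zs y where z: "subseq (zs @ [y]) (xs @ ys)" "length zs = j" "sorted_wrt (<) zs"
    "\<forall>z\<in>set zs. y < z"
    by (auto simp: has_inc_drop_def)
  then obtain us vs where uv: "zs @ [y] = us @ vs" "subseq us xs" "subseq vs ys"
    by (auto elim: subseq_appendE)
  show "has_inc j xs \<or> has_inc_drop j ys"
  proof (cases vs rule: rev_cases)
    case Nil
    then have "has_inc_drop j xs"
      using z uv unfolding has_inc_drop_def by auto
    then show ?thesis by (simp add: has_inc_drop_imp_has_inc)
  next
    case (snoc ws w)
    with uv have zs: "zs = us @ ws" "w = y" by auto
    have "us = [] \<or> ws = []"
      using z uv zs snoc assms subseq_set_subset[of us xs] subseq_set_subset[of vs ys]
      by (cases us; cases ws; force)
    then show ?thesis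
    proof
      assume "us = []"
      with z uv zs snoc have "has_inc_drop j ys"
        unfolding has_inc_drop_def by (metis append_Nil)
      then show ?thesis ..
    next
      assume "ws = []"
      with z uv zs have "has_inc j xs"
        unfolding has_inc_def by auto
      then show ?thesis ..
    qed
  qed
next
  assume "has_inc j xs \<or> has_inc_drop j ys"
  then show "has_inc_drop j (xs @ ys)"
  proof
    assume "has_inc j xs"
    then obtain zs where z: "subseq zs xs" "length zs = j" "sorted_wrt (<) zs"
      by (auto simp: has_inc_def)
    obtain y where "y \<in> set ys" using assms(2) by (cases ys) auto
    then have "subseq (zs @ [y]) (xs @ ys)"
      using z by (simp add: list_emb_append_mono subseq_singleton_left)
    with z show ?thesis
      using assms \<open>y \<in> set ys\<close> subseq_set_subset[OF z(1)] unfolding has_inc_drop_def by blast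
  qed (auto simp: has_inc_drop_def)
qed

section \<open>Avoidance of 132 in direct and skew sums\<close>

lemma avoids_subseq: "avoids p t \<Longrightarrow> subseq q p \<Longrightarrow> avoids q t"
  unfolding avoids_def by (meson subseq_order.trans)

lemma avoids_132_snoc_max:
  assumes "\<forall>x\<in>set q. x < M"
  shows "avoids (q @ [M]) [1, 3, 2] \<longleftrightarrow> avoids q [1, 3, 2]"
proof
  assume av: "avoids q [1, 3, 2]"
  have False if s: "subseq [a, c, b] (q @ [M])" and lt: "a < b" "b < c" for a b c
  proof -
    obtain us vs where uv: "[a, c, b] = us @ vs" "subseq us q" "subseq vs [M]"
      using s by (auto elim: subseq_appendE)
    have "length vs \<le> 1" using list_emb_length[OF uv(3)] by simp
    \<comment> \<open>Only the last entry \<open>b\<close> can be \<open>M\<close>, but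
      \<open>b\<close> is exceeded by \<open>c\<close>.\<close>
    then consider "vs = []" | "us = [a, c]" "vs = [b]"
      using uv(1) by (cases vs rule: rev_cases) auto
    then show False
    proof cases
      case 1
      then have "subseq [a, c, b] q" using uv by simp
      then show ?thesis using av lt unfolding avoids_132_iff by blast
    next
      case 2
      then show ?thesis
        using uv lt assms subseq_set_subset[OF uv(2)] subseq_set_subset[OF uv(3)] by auto
    qed
  qed
  then show "avoids (q @ [M]) [1, 3, 2]"
    unfolding avoids_132_iff by blast
next
  assume "avoids (q @ [M]) [1, 3, 2]"
  then show "avoids q [1, 3, 2]"
    by (rule avoids_subseq) auto
qed

lemma avoids_132_skew_append:
  assumes "\<forall>x\<in>set xs. \<forall>y\<in>set ys. y < x"
  shows "avoids (xs @ ys) [1, 3, 2] \<longleftrightarrow> avoids xs [1, 3, 2] \<and> avoids ys [1, 3, 2]"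
proof
  assume av: "avoids xs [1, 3, 2] \<and> avoids ys [1, 3, 2]"
  have False if s: "subseq [a, c, b] (xs @ ys)" and lt: "a < b" "b < c" for a b c
  proof -
    obtain us vs where uv: "[a, c, b] = us @ vs" "subseq us xs" "subseq vs ys"
      using s by (auto elim: subseq_appendE)
    \<comment> \<open>An occurrence meeting both blocks has \<open>a\<close> in \<open>xs\<close>
      and \<open>b\<close> in \<open>ys\<close>, against \<open>a < b\<close>.\<close>
    consider "us = []" | "vs = []" | us' vs' where "us = a # us'" "vs = vs' @ [b]"
      using uv(1) by (cases us; cases vs rule: rev_cases) auto
    then show False
    proof cases
      case 1
      then have "subseq [a, c, b] ys" using uv by simp
      then show ?thesis using av lt unfolding avoids_132_iff by blast
    next
      case 2
      then have "subseq [a, c, b] xs" using uv by simp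
      then show ?thesis using av lt unfolding avoids_132_iff by blast
    next
      case 3
      then show ?thesis
        using uv lt assms subseq_set_subset[OF uv(2)] subseq_set_subset[OF uv(3)] by fastforce
    qed
  qed
  then show "avoids (xs @ ys) [1, 3, 2]"
    unfolding avoids_132_iff by blast
next
  assume "avoids (xs @ ys) [1, 3, 2]"
  moreover have "subseq xs (xs @ ys)" "subseq ys (xs @ ys)" by auto
  ultimately show "avoids xs [1, 3, 2] \<and> avoids ys [1, 3, 2]"
    using avoids_subseq by blast
qed

subsection \<open>Decomposition at the largest entry\<close>

definition dumont_step :: "nat \<Rightarrow> nat \<Rightarrow> bool" where
  "dumont_step x y \<longleftrightarrow> (if even x then y < x else x < y)"

text \<open>An even entry needs a successor, so beyond the condition on neighbours only the parity
  of the last entry remains.\<close>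

lemma dumont_iff_successively:
  "dumont p \<longleftrightarrow> successively dumont_step p \<and> (p = [] \<or> odd (last p))"
proof (cases "p = []")
  case False
  have *: "(\<forall>i < length p. P i) \<longleftrightarrow> (\<forall>i. Suc i < length p \<longrightarrow> P i) \<and> P (length p - 1)" for P
    using False
    by (metis Suc_lessI Suc_pred' diff_less length_greater_0_conv lessI Suc_lessD
        less_imp_diff_less diff_Suc_1)
  show ?thesis
    using False
    unfolding dumont_def * successively_conv_nth dumont_step_def
    by (auto simp: last_conv_nth)
qed (simp add: dumont_def)

text \<open>Evenness of the shift keeps parities.\<close>

lemma dumont_map_add:
  assumes "even c"
  shows "dumont (map (\<lambda>x. x + c) p) \<longleftrightarrow> dumont p"
  using assms
  by (cases "p = []") (simp_all add: dumont_iff_successively successively_map dumont_step_def last_map)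

text \<open>The rise from \<open>last q\<close> to \<open>M\<close> forces \<open>last q\<close> to
  be odd, which is exactly the end condition for \<open>q\<close>.\<close>

lemma dumont_snoc_odd_max:
  assumes "\<forall>x\<in>set q. x < M" "odd M"
  shows "dumont (q @ [M]) \<longleftrightarrow> dumont q"
proof (cases "q = []")
  case False
  then have "last q < M" using assms by simp
  then show ?thesis
    using assms(2) False
    by (auto simp: dumont_iff_successively successively_append_iff dumont_step_def)
qed (use assms in \<open>simp add: dumont_iff_successively\<close>)

text \<open>The rise into \<open>N\<close> gives the end condition for \<open>l\<close>;
  \<open>N\<close> is even and needs a successor, which is automatically smaller.\<close>

lemma dumont_even_max:
  assumes "\<forall>x\<in>set l. x < N" "\<forall>x\<in>set r. x < N" "even N"
  shows "dumont (l @ N # r) \<longleftrightarrow> dumont l \<and> dumont r \<and> r \<noteq> []"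
proof -
  have "l \<noteq> [] \<Longrightarrow> last l < N" "r \<noteq> [] \<Longrightarrow> hd r < N"
    using assms by auto
  then show ?thesis
    using assms(3)
    by (cases "l = []"; cases "r = []")
      (auto simp: dumont_iff_successively successively_append_iff successively_Cons dumont_step_def)
qed

lemma dumont_odd_max_last:
  assumes "dumont p" "M \<in> set p" "odd M" "\<forall>x\<in>set p. x \<le> M"
  obtains q where "p = q @ [M]"
proof -
  obtain l r where p: "p = l @ M # r"
    using split_list[OF assms(2)] by blast
  have "r = []"
  proof (rule ccontr)
    assume "r \<noteq> []"
    then have "M < hd r"
      using assms(1,3) unfolding p dumont_iff_successively
      by (auto simp: successively_append_iff successively_Cons dumont_step_def)
    moreover have "hd r \<le> M" using assms(4) p \<open>r \<noteq> []\<close> by auto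
    ultimately show False by simp
  qed
  with p that show thesis by blast
qed

lemma dumont_even_not_min:
  assumes "dumont p" "x \<in> set p" "even x"
  obtains y where "y \<in> set p" "y < x"
  using assms unfolding dumont_def in_set_conv_nth by metis

section \<open>Odd length and blocks of consecutive values\<close>

definition dumont132 :: "nat \<Rightarrow> nat list set" where
  "dumont132 n = {p \<in> permutations_of_set {1..n}. dumont p \<and> avoids p [1, 3, 2]}"

lemma mem_dumont132_iff:
  "p \<in> dumont132 n \<longleftrightarrow> set p = {1..n} \<and> distinct p \<and> dumont p \<and> avoids p [1, 3, 2]"
  by (auto simp: dumont132_def permutations_of_set_def)

lemma finite_dumont132 [simp]: "finite (dumont132 n)"
  by (simp add: dumont132_def)

lemma dumont132_0: "dumont132 0 = {[]}"
proof -
  have "avoids [] [1, 3, 2]"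
    unfolding avoids_132_iff by simp
  then show ?thesis
    by (auto simp: mem_dumont132_iff dumont_def)
qed

lemma length_dumont132: "p \<in> dumont132 n \<Longrightarrow> length p = n"
  using distinct_card by (fastforce simp: mem_dumont132_iff)

lemma dumont132_odd: "dumont132 (2 * m + 1) = (\<lambda>q. q @ [2 * m + 1]) ` dumont132 (2 * m)"
proof (intro equalityI subsetI)
  fix p assume "p \<in> dumont132 (2 * m + 1)"
  then have p: "set p = {1..2 * m + 1}" "distinct p" "dumont p" "avoids p [1, 3, 2]"
    unfolding mem_dumont132_iff by blast+
  obtain q where q: "p = q @ [2 * m + 1]"
    by (rule dumont_odd_max_last[of p "2 * m + 1"]) (use p in auto)
  have set: "set q = {1..2 * m}"
  proof -
    have "set q = set p - {2 * m + 1}" using q p(2) by auto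
    then show ?thesis using p(1) by auto
  qed
  then have lt: "\<forall>x\<in>set q. x < 2 * m + 1" by auto
  have "q \<in> dumont132 (2 * m)"
    unfolding mem_dumont132_iff
    using set p q dumont_snoc_odd_max[OF lt] avoids_132_snoc_max[OF lt] by simp
  with q show "p \<in> (\<lambda>q. q @ [2 * m + 1]) ` dumont132 (2 * m)" by blast
next
  fix p assume "p \<in> (\<lambda>q. q @ [2 * m + 1]) ` dumont132 (2 * m)"
  then obtain q where q: "q \<in> dumont132 (2 * m)" "p = q @ [2 * m + 1]" by blast
  then have lt: "\<forall>x\<in>set q. x < 2 * m + 1" by (auto simp: mem_dumont132_iff)
  show "p \<in> dumont132 (2 * m + 1)"
    using q dumont_snoc_odd_max[OF lt] avoids_132_snoc_max[OF lt]
    by (auto simp: mem_dumont132_iff)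
qed

lemma dumont132_map_add_iff:
  assumes "set p = {2 * b + 1..2 * b + n}"
  shows "p \<in> (map (\<lambda>x. x + 2 * b)) ` dumont132 n \<longleftrightarrow> distinct p \<and> dumont p \<and> avoids p [1, 3, 2]"
proof -
  have sm: "strict_mono (\<lambda>x::nat. x + 2 * b)" by (simp add: strict_mono_def)
  \<comment> \<open>Truncated subtraction is undone because every entry exceeds
    \<open>2 * b\<close>.\<close>
  have eq: "map (\<lambda>x. x + 2 * b) (map (\<lambda>x. x - 2 * b) p) = p"
    using assms by (auto intro!: map_idI)
  have set: "set (map (\<lambda>x. x - 2 * b) p) = {1..n}"
  proof -
    have "(\<lambda>x. x - 2 * b) ` {2 * b + 1..2 * b + n} = {1..n}"
      by (auto simp: image_iff intro!: bexI[of _ "_ + 2 * b"])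
    then show ?thesis using assms by simp
  qed
  show ?thesis
  proof
    assume "p \<in> (map (\<lambda>x. x + 2 * b)) ` dumont132 n"
    then show "distinct p \<and> dumont p \<and> avoids p [1, 3, 2]"
      using avoids_map_strict_mono[OF sm] dumont_map_add[of "2 * b"]
      by (auto simp: mem_dumont132_iff distinct_map inj_on_def)
  next
    assume *: "distinct p \<and> dumont p \<and> avoids p [1, 3, 2]"
    have "map (\<lambda>x. x - 2 * b) p \<in> dumont132 n"
      unfolding mem_dumont132_iff
      using * set avoids_map_strict_mono[OF sm, of "map (\<lambda>x. x - 2 * b) p"]
        dumont_map_add[of "2 * b" "map (\<lambda>x. x - 2 * b) p"]
        distinct_map[of "\<lambda>x. x + 2 * b" "map (\<lambda>x. x - 2 * b) p"]
      unfolding eq by auto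
    then show "p \<in> (map (\<lambda>x. x + 2 * b)) ` dumont132 n"
      using eq by (metis imageI)
  qed
qed

section \<open>The two forms in even length\<close>

definition cap :: "nat \<Rightarrow> nat list \<Rightarrow> nat list" where
  "cap m q = [2 * m + 2] @ q @ [2 * m + 1]"

text \<open>The length of \<open>r\<close> is \<open>2 * b\<close>, so the shift puts
  \<open>l\<close> above \<open>r\<close>. The bracketing exposes two appended maxima inside a skew
  sum.\<close>

definition glue :: "nat \<Rightarrow> nat \<times> nat list \<times> nat list \<Rightarrow> nat list" where
  "glue m = (\<lambda>(b, l, r). ((map (\<lambda>x. x + 2 * b) l @ [2 * m + 1]) @ [2 * m + 2]) @ r)"

text \<open>With \<open>b = Max B\<close>, no value up to \<open>b\<close> can lie in
  \<open>A\<close>, since all of \<open>A\<close> exceeds \<open>b\<close>.\<close>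

lemma initial_segment_split:
  fixes A B :: "nat set"
  assumes "A \<union> B = {1..n}" "\<forall>x\<in>A. \<forall>y\<in>B. y < x" "B \<noteq> {}"
  obtains b where "1 \<le> b" "b \<le> n" "B = {1..b}" "A = {b + 1..n}"
proof -
  have fin: "finite B" using assms(1) by (metis finite_Un finite_atLeastAtMost)
  define b where "b = Max B"
  have b: "b \<in> B" "\<And>y. y \<in> B \<Longrightarrow> y \<le> b" using fin assms(3) by (auto simp: b_def)
  have bn: "1 \<le> b" "b \<le> n" using b(1) assms(1) by auto
  have B: "B = {1..b}"
  proof (intro equalityI subsetI)
    fix x assume "x \<in> {1..b}"
    then have "x \<in> A \<union> B" using assms(1) bn by auto
    moreover have "x \<notin> A" using \<open>x \<in> {1..b}\<close> b(1) assms(2) by force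
    ultimately show "x \<in> B" by blast
  next
    fix x assume "x \<in> B"
    then show "x \<in> {1..b}" using b(2) assms(1) by auto
  qed
  have "A = {b + 1..n}"
  proof (intro equalityI subsetI)
    fix x assume "x \<in> A"
    then have "x \<in> {1..n}" "b < x" using assms(1,2) b(1) by blast+
    then show "x \<in> {b + 1..n}" by auto
  next
    fix x assume "x \<in> {b + 1..n}"
    then have "x \<in> A \<union> B" "x \<notin> B" using assms(1) B by auto
    then show "x \<in> A" by blast
  qed
  with bn B that show thesis by blast
qed

lemma cap_mem_dumont132:
  assumes "q \<in> dumont132 (2 * m)"
  shows "cap m q \<in> dumont132 (2 * m + 2)"
proof -
  have q': "q @ [2 * m + 1] \<in> dumont132 (2 * m + 1)"
    using assms dumont132_odd by blast
  then have lt: "\<forall>x\<in>set (q @ [2 * m + 1]). x < 2 * m + 2"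
    by (auto simp: mem_dumont132_iff)
  have 1: "dumont (cap m q)"
    using dumont_even_max[of "[]" "2 * m + 2" "q @ [2 * m + 1]"] lt q'
    by (auto simp: cap_def mem_dumont132_iff dumont_def)
  have "avoids [2 * m + 2] [1, 3, 2]"
    unfolding avoids_132_iff by simp
  then have 2: "avoids (cap m q) [1, 3, 2]"
    unfolding cap_def using lt q' avoids_132_skew_append[of "[2 * m + 2]" "q @ [2 * m + 1]"]
    unfolding mem_dumont132_iff by force
  have "set (cap m q) = {1..2 * m + 2}" "distinct (cap m q)"
    using assms by (auto simp: cap_def mem_dumont132_iff)
  with 1 2 show ?thesis unfolding mem_dumont132_iff by blast
qed

lemma glue_mem_dumont132:
  assumes "b \<in> {1..m}" "l \<in> dumont132 (2 * (m - b))" "r \<in> dumont132 (2 * b)"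
  shows "glue m (b, l, r) \<in> dumont132 (2 * m + 2)"
proof -
  let ?l = "map (\<lambda>x. x + 2 * b) l"
  have "(\<lambda>x. x + 2 * b) ` {1..2 * (m - b)} = {2 * b + 1..2 * b + 2 * (m - b)}"
    by (metis add.commute image_add_atLeastAtMost')
  then have sl: "set ?l = {2 * b + 1..2 * b + 2 * (m - b)}"
    using assms(2) by (simp add: mem_dumont132_iff)
  then have l: "distinct ?l" "dumont ?l" "avoids ?l [1, 3, 2]"
    using dumont132_map_add_iff[OF sl] assms(2) by blast+
  have sl': "set ?l = {2 * b + 1..2 * m}" using sl assms(1) by auto
  have r: "set r = {1..2 * b}" "distinct r" "dumont r" "avoids r [1, 3, 2]"
    using assms(3) unfolding mem_dumont132_iff by blast+
  have lt1: "\<forall>x\<in>set ?l. x < 2 * m + 1" unfolding sl' by auto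
  have sl1: "set (?l @ [2 * m + 1]) = {2 * b + 1..2 * m + 1}"
    unfolding set_append sl' using assms(1) by auto
  have lt2: "\<forall>x\<in>set (?l @ [2 * m + 1]). x < 2 * m + 2" unfolding sl1 by auto
  have lt3: "\<forall>x\<in>set r. x < 2 * m + 2" unfolding r using assms(1) by auto
  have sl2: "set ((?l @ [2 * m + 1]) @ [2 * m + 2]) = {2 * b + 1..2 * m + 2}"
    unfolding set_append[of "?l @ [2 * m + 1]"] sl1 using assms(1) by auto
  have gt: "\<forall>x\<in>set ((?l @ [2 * m + 1]) @ [2 * m + 2]). \<forall>y\<in>set r. y < x"
    unfolding sl2 r by auto
  have "r \<noteq> []" using r(1) assms(1) by auto
  then have "dumont ((?l @ [2 * m + 1]) @ (2 * m + 2) # r)"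
    using dumont_even_max[OF lt2 lt3] dumont_snoc_odd_max[OF lt1] l r by simp
  moreover have "avoids (((?l @ [2 * m + 1]) @ [2 * m + 2]) @ r) [1, 3, 2]"
    unfolding avoids_132_skew_append[OF gt] avoids_132_snoc_max[OF lt2] avoids_132_snoc_max[OF lt1]
    using l r by blast
  moreover have "set (((?l @ [2 * m + 1]) @ [2 * m + 2]) @ r) = {1..2 * m + 2}"
    unfolding set_append[of _ r] sl2 r using assms(1) by auto
  moreover have "distinct (((?l @ [2 * m + 1]) @ [2 * m + 2]) @ r)"
    unfolding distinct_append[of _ r]
    using l(1) lt1 lt2 r(2) gt by fastforce
  ultimately show ?thesis
    unfolding mem_dumont132_iff glue_def by simp
qed

lemma dumont132_even_cases:
  assumes "p \<in> dumont132 (2 * m + 2)"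
  obtains q where "q \<in> dumont132 (2 * m)" "p = cap m q"
  | b l r where "b \<in> {1..m}" "l \<in> dumont132 (2 * (m - b))" "r \<in> dumont132 (2 * b)"
      "p = glue m (b, l, r)"
proof -
  let ?n = "2 * m + 2"
  have p: "set p = {1..?n}" "distinct p" "dumont p" "avoids p [1, 3, 2]"
    using assms unfolding mem_dumont132_iff by blast+
  have "?n \<in> set p" using p(1) by auto
  then obtain L R where LR: "p = L @ ?n # R" using split_list by metis
  have un: "set L \<union> set R = {1..2 * m + 1}"
  proof -
    have "set L \<union> set R = set p - {?n}" using LR p(2) by auto
    then show ?thesis using p(1) by auto
  qed
  then have "\<forall>x\<in>set L \<union> set R. x < ?n" by auto
  then have lt: "\<forall>x\<in>set L. x < ?n" "\<forall>x\<in>set R. x < ?n" by auto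
  \<comment> \<open>Otherwise \<open>x\<close>, the maximum and \<open>y\<close> would form
    132.\<close>
  have gt: "y < x" if "x \<in> set L" "y \<in> set R" for x y
  proof -
    have "subseq ([x] @ [?n] @ [y]) (L @ [?n] @ R)"
      using that by (intro list_emb_append_mono) (auto simp: subseq_singleton_left)
    then have "subseq [x, ?n, y] p" using LR by simp
    then have "\<not> x < y" using p(4) lt(2) that(2) unfolding avoids_132_iff by blast
    moreover have "x \<noteq> y" using p(2) LR that by auto
    ultimately show ?thesis by simp
  qed
  have D: "dumont L" "dumont R" "R \<noteq> []"
    using dumont_even_max[OF lt] p(3) LR by auto
  have av: "avoids L [1, 3, 2]" "avoids R [1, 3, 2]"
    by (rule avoids_subseq[OF p(4)], force simp: LR)+
  have dist: "distinct L" "distinct R" using p(2) LR by auto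
  obtain b where b: "1 \<le> b" "b \<le> 2 * m + 1" "set R = {1..b}" "set L = {b + 1..2 * m + 1}"
    by (rule initial_segment_split[OF un]) (use gt D in auto)
  have R: "R \<in> dumont132 b" using b D av dist unfolding mem_dumont132_iff by blast
  show thesis
  proof (cases "even b")
    case False
    \<comment> \<open>Otherwise \<open>b + 1\<close> would be an even least entry of
      \<open>L\<close>.\<close>
    have "b = 2 * m + 1"
    proof (rule ccontr)
      assume "b \<noteq> 2 * m + 1"
      then have "b + 1 \<in> set L" unfolding b using b(2) by auto
      then obtain y where "y \<in> set L" "y < b + 1"
        using dumont_even_not_min[OF D(1), of "b + 1"] False by auto
      then show False unfolding b by auto
    qed
    moreover from this have "L = []" using b(4) by simp
    ultimately show thesis
      using R LR dumont132_odd[of m] that(1) by (auto simp: cap_def)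
  next
    case True
    then obtain c where c: "b = 2 * c" by blast
    have cm: "c \<in> {1..m}" using c b by auto
    \<comment> \<open>As \<open>b\<close> is even, \<open>b <= 2 * m\<close>; hence
      \<open>2 * m + 1\<close> lies in \<open>L\<close> and is its odd maximum.\<close>
    obtain L' where L': "L = L' @ [2 * m + 1]"
      by (rule dumont_odd_max_last[of L "2 * m + 1"]) (use D dist b c in auto)
    have "set L' = set L - {2 * m + 1}" using L' dist(1) by auto
    then have s: "set L' = {2 * c + 1..2 * c + 2 * (m - c)}" using b c cm by auto
    then have lt': "\<forall>x\<in>set L'. x < 2 * m + 1" using cm by auto
    have "distinct L' \<and> dumont L' \<and> avoids L' [1, 3, 2]"
      using dist D(1) av(1) dumont_snoc_odd_max[OF lt'] avoids_132_snoc_max[OF lt'] L' by simp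
    then obtain l where "l \<in> dumont132 (2 * (m - c))" "L' = map (\<lambda>x. x + 2 * c) l"
      using dumont132_map_add_iff[OF s] by blast
    then show thesis
      using that(2)[of c l R] cm R L' LR c by (simp add: glue_def)
  qed
qed

definition splits :: "nat \<Rightarrow> (nat list \<Rightarrow> bool) \<Rightarrow> (nat list \<Rightarrow> bool) \<Rightarrow> (nat \<times> nat list \<times> nat list) set" where
  "splits m P Q = (SIGMA b:{1..m}. {l \<in> dumont132 (2 * (m - b)). P l} \<times> {r \<in> dumont132 (2 * b). Q r})"

text \<open>The unique entry \<open>2 * m + 1\<close> marks the cut, the length of \<open>r\<close>
  determines \<open>b\<close>, and then the shift of \<open>l\<close> can be undone.\<close>

lemma inj_on_glue: "inj_on (glue m) (splits m P Q)"
proof (rule inj_onI)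
  fix u v assume "u \<in> splits m P Q" "v \<in> splits m P Q" and eq: "glue m u = glue m v"
  moreover obtain b l r b' l' r' where uv: "u = (b, l, r)" "v = (b', l', r')"
    by (metis prod_cases3)
  ultimately have 1: "b \<in> {1..m}" "l \<in> dumont132 (2 * (m - b))" "r \<in> dumont132 (2 * b)"
    and 2: "b' \<in> {1..m}" "l' \<in> dumont132 (2 * (m - b'))" "r' \<in> dumont132 (2 * b')"
    by (auto simp: splits_def)
  have "2 * m + 1 \<notin> set (map (\<lambda>x. x + 2 * b) l)" "2 * m + 1 \<notin> set ((2 * m + 2) # r)"
    using 1 by (auto simp: mem_dumont132_iff)
  moreover have "map (\<lambda>x. x + 2 * b) l @ (2 * m + 1) # (2 * m + 2) # r
      = map (\<lambda>x. x + 2 * b') l' @ (2 * m + 1) # (2 * m + 2) # r'"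
    using eq by (simp add: uv glue_def)
  ultimately have "map (\<lambda>x. x + 2 * b) l = map (\<lambda>x. x + 2 * b') l' \<and> (2 * m + 2) # r = (2 * m + 2) # r'"
    by (rule append_Cons_eq_iff[THEN iffD1])
  then have *: "map (\<lambda>x. x + 2 * b) l = map (\<lambda>x. x + 2 * b') l'" "r = r'"
    by simp_all
  then have "b = b'" using 1(3) 2(3) length_dumont132[of r "2 * b"] length_dumont132[of r' "2 * b'"] by simp
  moreover from this have "l = l'"
    using * by (metis (mono_tags, lifting) add_right_cancel injI inj_map_eq_map)
  ultimately show "u = v" using * uv by simp
qed

text \<open>The first entry decides: it is \<open>2 * m + 2\<close> for \<open>cap\<close> and at
  most \<open>2 * m + 1\<close> for \<open>glue\<close>.\<close>

lemma cap_neq_glue: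
  assumes "b \<in> {1..m}" "l \<in> dumont132 (2 * (m - b))"
  shows "cap m q \<noteq> glue m (b, l, r)"
proof (cases l)
  case (Cons a l')
  then have "a \<in> {1..2 * (m - b)}" using assms(2) by (auto simp: mem_dumont132_iff)
  then have "a + 2 * b \<noteq> 2 * m + 2" using assms(1) by auto
  then show ?thesis using Cons by (auto simp: cap_def glue_def)
qed (simp add: cap_def glue_def)

text \<open>Stated for a general \<open>P\<close> so that it serves both statistics;
  \<open>P1\<close> and \<open>P2\<close> are what \<open>P\<close> imposes on \<open>q\<close> and
  \<open>l\<close>.\<close>

lemma card_dumont132_even:
  assumes cap: "\<And>q. q \<in> dumont132 (2 * m) \<Longrightarrow> P (cap m q) \<longleftrightarrow> P1 q"
    and glue: "\<And>b l r. b \<in> {1..m} \<Longrightarrow> l \<in> dumont132 (2 * (m - b)) \<Longrightarrow> r \<in> dumont132 (2 * b) \<Longrightarrow>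
      P (glue m (b, l, r)) \<longleftrightarrow> P2 l \<and> P r"
  shows "card {p \<in> dumont132 (2 * m + 2). P p} =
    card {q \<in> dumont132 (2 * m). P1 q} +
    (\<Sum>b=1..m. card {l \<in> dumont132 (2 * (m - b)). P2 l} * card {r \<in> dumont132 (2 * b). P r})"
proof -
  let ?A = "cap m ` {q \<in> dumont132 (2 * m). P1 q}" and ?B = "glue m ` splits m P2 P"
  have eq: "{p \<in> dumont132 (2 * m + 2). P p} = ?A \<union> ?B"
  proof (intro equalityI subsetI)
    fix p assume p: "p \<in> {p \<in> dumont132 (2 * m + 2). P p}"
    then have "p \<in> dumont132 (2 * m + 2)" by simp
    then show "p \<in> ?A \<union> ?B"
    proof (cases rule: dumont132_even_cases)
      case (1 q)
      then show ?thesis using p cap by auto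
    next
      case (2 b l r)
      then have "(b, l, r) \<in> splits m P2 P"
        using p glue by (auto simp: splits_def)
      then show ?thesis using 2 by blast
    qed
  next
    fix p assume "p \<in> ?A \<union> ?B"
    then show "p \<in> {p \<in> dumont132 (2 * m + 2). P p}"
      using cap glue cap_mem_dumont132 glue_mem_dumont132 by (auto simp: splits_def)
  qed
  have fin: "finite (splits m P2 P)"
    by (auto simp: splits_def)
  have "?A \<inter> ?B = {}"
    using cap_neq_glue by (force simp: splits_def)
  then have "card (?A \<union> ?B) = card ?A + card ?B"
    using fin by (intro card_Un_disjoint) auto
  also have "card ?A = card {q \<in> dumont132 (2 * m). P1 q}"
    by (intro card_image) (auto simp: cap_def inj_on_def)
  also have "card ?B = card (splits m P2 P)"
    by (intro card_image inj_on_glue)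
  also have "\<dots> = (\<Sum>b=1..m. card {l \<in> dumont132 (2 * (m - b)). P2 l} * card {r \<in> dumont132 (2 * b). P r})"
    unfolding splits_def by (subst card_SigmaI) (auto simp: card_cartesian_product)
  finally show ?thesis using eq by simp
qed

subsection \<open>Generating functions\<close>

lemma cap_bounds:
  assumes "q \<in> dumont132 (2 * m)"
  shows "\<forall>x\<in>set q. x < 2 * m + 1"
    and "\<forall>x\<in>set [2 * m + 2]. \<forall>y\<in>set (q @ [2 * m + 1]). y < x"
  using assms by (auto simp: mem_dumont132_iff)

lemma glue_bounds:
  assumes "b \<in> {1..m}" "l \<in> dumont132 (2 * (m - b))" "r \<in> dumont132 (2 * b)"
  shows "\<forall>x\<in>set (map (\<lambda>x. x + 2 * b) l). x < 2 * m + 1"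
    and "\<forall>x\<in>set (map (\<lambda>x. x + 2 * b) l @ [2 * m + 1]). x < 2 * m + 2"
    and "\<forall>x\<in>set ((map (\<lambda>x. x + 2 * b) l @ [2 * m + 1]) @ [2 * m + 2]). \<forall>y\<in>set r. y < x"
    and "r \<noteq> []"
proof -
  have "set l = {1..2 * (m - b)}" "set r = {1..2 * b}" "2 * b + 2 * (m - b) = 2 * m"
    using assms by (auto simp: mem_dumont132_iff)
  then show "\<forall>x\<in>set (map (\<lambda>x. x + 2 * b) l). x < 2 * m + 1"
    and "\<forall>x\<in>set (map (\<lambda>x. x + 2 * b) l @ [2 * m + 1]). x < 2 * m + 2"
    and "\<forall>x\<in>set ((map (\<lambda>x. x + 2 * b) l @ [2 * m + 1]) @ [2 * m + 2]). \<forall>y\<in>set r. y < x"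
    and "r \<noteq> []"
    using assms(1) by auto
qed

text \<open>The leading maximum only gives a run of length 1, too short here; the final
  \<open>2 * m + 1\<close> adds one to the run in \<open>q\<close>.\<close>

lemma has_inc_cap:
  assumes "q \<in> dumont132 (2 * m)"
  shows "has_inc (Suc (Suc j)) (cap m q) \<longleftrightarrow> has_inc (Suc j) q"
  unfolding cap_def has_inc_skew_append[OF cap_bounds(2)[OF assms]]
    has_inc_snoc_max[OF cap_bounds(1)[OF assms]]
  using has_inc_imp_le_length[of "Suc (Suc j)" "[2 * m + 2]"] by auto

lemma has_inc_drop_cap:
  assumes "q \<in> dumont132 (2 * m)" "j \<ge> 2"
  shows "has_inc_drop j (cap m q) \<longleftrightarrow> has_inc_drop j q"
  unfolding cap_def
  using has_inc_drop_skew_append[OF cap_bounds(2)[OF assms(1)]]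
    has_inc_drop_snoc_max[OF cap_bounds(1)[OF assms(1)]]
    has_inc_imp_le_length[of j "[2 * m + 2]"] assms(2) by auto

context
  fixes m b l r
  assumes blr: "b \<in> {1..m}" "l \<in> dumont132 (2 * (m - b))" "r \<in> dumont132 (2 * b)"
begin

text \<open>Each of the two appended maxima adds one.\<close>

lemma has_inc_glue_prefix:
  "has_inc (Suc (Suc j)) ((map (\<lambda>x. x + 2 * b) l @ [2 * m + 1]) @ [2 * m + 2]) \<longleftrightarrow> has_inc j l"
  unfolding has_inc_snoc_max[OF glue_bounds(2)[OF blr]] has_inc_snoc_max[OF glue_bounds(1)[OF blr]]
  by (rule has_inc_map_strict_mono) (simp add: strict_mono_def)

lemma has_inc_glue:
  "has_inc (Suc (Suc j)) (glue m (b, l, r)) \<longleftrightarrow> has_inc j l \<or> has_inc (Suc (Suc j)) r"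
  unfolding glue_def prod.case has_inc_skew_append[OF glue_bounds(3)[OF blr]] has_inc_glue_prefix ..

lemma has_inc_drop_glue:
  "has_inc_drop (Suc (Suc j)) (glue m (b, l, r)) \<longleftrightarrow> has_inc j l \<or> has_inc_drop (Suc (Suc j)) r"
  unfolding glue_def prod.case has_inc_drop_skew_append[OF glue_bounds(3,4)[OF blr]]
    has_inc_glue_prefix ..

end

section \<open>Functional equations and their solutions\<close>

definition even_gf :: "(nat list \<Rightarrow> bool) \<Rightarrow> rat fps" where
  "even_gf P = Abs_fps (\<lambda>m. of_nat (card {p \<in> dumont132 (2 * m). P p})) oo fps_X\<^sup>2"

lemma even_gf_nth:
  "fps_nth (even_gf P) n = (if even n then of_nat (card {p \<in> dumont132 n. P p}) else 0)"
  by (auto simp: even_gf_def fps_nth_compose_X_power)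

text \<open>The factor \<open>even_gf P - 1\<close> removes the empty \<open>r\<close>, which
  \<open>nil\<close> makes the constant term; each of the two forms adds two entries, hence
  \<open>fps_X\<^sup>2\<close>.\<close>

lemma even_gf_rec:
  assumes nil: "P []"
    and cap: "\<And>m q. q \<in> dumont132 (2 * m) \<Longrightarrow> P (cap m q) \<longleftrightarrow> P1 q"
    and glue: "\<And>m b l r. b \<in> {1..m} \<Longrightarrow> l \<in> dumont132 (2 * (m - b)) \<Longrightarrow> r \<in> dumont132 (2 * b) \<Longrightarrow>
      P (glue m (b, l, r)) \<longleftrightarrow> P2 l \<and> P r"
  shows "even_gf P = 1 + fps_X\<^sup>2 * even_gf P1 + fps_X\<^sup>2 * even_gf P2 * (even_gf P - 1)"
proof -
  define C where "C = (\<lambda>P. Abs_fps (\<lambda>m. of_nat (card {p \<in> dumont132 (2 * m). P p}) :: rat))"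
  have C0: "fps_nth (C P) 0 = 1"
  proof -
    have "{p \<in> dumont132 0. P p} = {[]}" using nil by (auto simp: dumont132_0)
    then show ?thesis by (simp add: C_def)
  qed
  have "C P = 1 + fps_X * (C P1 + (C P - 1) * C P2)"
  proof (rule fps_ext)
    fix n
    show "fps_nth (C P) n = fps_nth (1 + fps_X * (C P1 + (C P - 1) * C P2)) n"
    proof (cases n)
      case 0
      then show ?thesis using C0 by simp
    next
      case (Suc m)
      have "fps_nth ((C P - 1) * C P2) m = (\<Sum>b=0..m. fps_nth (C P - 1) b * fps_nth (C P2) (m - b))"
        by (rule fps_mult_nth)
      \<comment> \<open>The term \<open>b = 0\<close> vanishes, as \<open>C P\<close> has constant
        coefficient 1.\<close>
      also have "\<dots> = (\<Sum>b=1..m. fps_nth (C P - 1) b * fps_nth (C P2) (m - b))"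
        using C0 by (simp add: sum.atLeast_Suc_atMost)
      also have "\<dots> = (\<Sum>b=1..m. fps_nth (C P) b * fps_nth (C P2) (m - b))"
        by (intro sum.cong) auto
      finally show ?thesis
        using card_dumont132_even[of m P P1 P2, OF cap glue]
        by (simp add: Suc C_def mult.commute)
    qed
  qed
  \<comment> \<open>Passing from half the length to the length substitutes
    \<open>fps_X\<^sup>2\<close> for \<open>fps_X\<close>.\<close>
  then have "C P oo fps_X\<^sup>2 = (1 + fps_X * (C P1 + (C P - 1) * C P2)) oo fps_X\<^sup>2"
    by simp
  moreover have "even_gf Q = C Q oo fps_X\<^sup>2" for Q
    by (simp add: even_gf_def C_def)
  ultimately show ?thesis
    by (simp add: fps_compose_add_distrib fps_compose_mult_distrib fps_compose_sub_distrib
        distrib_left mult_ac add.assoc)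
qed

lemma has_inc_drop_imp_less_length: "has_inc_drop j p \<Longrightarrow> j < length p"
  unfolding has_inc_drop_def using list_emb_length by fastforce

lemma fps_eq_add_divide:
  fixes f a d :: "'a :: field fps"
  assumes "f = c + a + (1 - d) * (f - c)" "fps_nth d 0 \<noteq> 0"
  shows "f = c + a / d"
proof -
  have "d \<noteq> 0" using assms(2) by auto
  have "a = d * (f - c)" using assms(1) by (simp add: algebra_simps)
  then have "a / d = f - c" using \<open>d \<noteq> 0\<close> by simp
  then show ?thesis by simp
qed

text \<open>The recursion of \<open>F\<close> mirrors the two forms: \<open>cap\<close> lowers the
  threshold by one for \<open>q\<close>, \<open>glue\<close> lowers it by two for \<open>l\<close>
  and keeps it for \<open>r\<close>.\<close>

lemma even_gf_no_inc: "even_gf (\<lambda>p. \<not> has_inc j p) = F j"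
proof (induction j rule: F.induct)
  case 1
  \<comment> \<open>Even the empty permutation has an increasing subsequence of length 0, so nothing
    is counted.\<close>
  show ?case by (simp add: fps_eq_iff even_gf_nth)
next
  case 2
  have "{p \<in> dumont132 n. \<not> has_inc (Suc 0) p} = (if n = 0 then {[]} else {})" for n
  proof -
    have "has_inc (Suc 0) p \<longleftrightarrow> p \<noteq> []" for p
    proof
      assume "p \<noteq> []"
      then have "subseq [hd p] p" by (simp add: subseq_singleton_left)
      then show "has_inc (Suc 0) p" unfolding has_inc_def by force
    qed (use has_inc_imp_le_length in fastforce)
    then show ?thesis using length_dumont132 by (auto simp: dumont132_0)
  qed
  then show ?case by (simp add: fps_eq_iff even_gf_nth)
next
  case (3 j)
  let ?f = "even_gf (\<lambda>p. \<not> has_inc (Suc (Suc j)) p)"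
  have "?f = 1 + fps_X\<^sup>2 * even_gf (\<lambda>p. \<not> has_inc (Suc j) p) +
      fps_X\<^sup>2 * even_gf (\<lambda>p. \<not> has_inc j p) * (?f - 1)"
    by (rule even_gf_rec)
      (use has_inc_imp_le_length[of "Suc (Suc j)" "[]"] has_inc_cap has_inc_glue in auto)
  then have "?f = 1 + fps_X\<^sup>2 * F (Suc j) / (1 - fps_X\<^sup>2 * F j)"
    unfolding 3 by (intro fps_eq_add_divide) simp_all
  then show ?case by simp
qed

lemma even_gf_no_inc_drop:
  "even_gf (\<lambda>p. \<not> has_inc_drop (Suc (Suc j)) p) = 1 + fps_X\<^sup>2 / (1 - fps_X\<^sup>2 - fps_X\<^sup>2 * F j)"
proof -
  let ?f = "even_gf (\<lambda>p. \<not> has_inc_drop (Suc (Suc j)) p)"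
  have "?f = 1 + fps_X\<^sup>2 * ?f + fps_X\<^sup>2 * even_gf (\<lambda>p. \<not> has_inc j p) * (?f - 1)"
    by (rule even_gf_rec)
      (use has_inc_drop_imp_less_length[of "Suc (Suc j)" "[]"] has_inc_drop_cap has_inc_drop_glue in auto)
  \<comment> \<open>Here \<open>cap\<close> keeps the condition, so \<open>?f\<close> itself
    appears; writing it as \<open>1 + (?f - 1)\<close> gives a linear equation for
    \<open>?f - 1\<close>.\<close>
  also have "\<dots> = 1 + fps_X\<^sup>2 + (1 - (1 - fps_X\<^sup>2 - fps_X\<^sup>2 * F j)) * (?f - 1)"
    unfolding even_gf_no_inc by (simp add: algebra_simps)
  finally show ?thesis by (rule fps_eq_add_divide) simp
qed

lemma card_dumont132_odd_no_inc_drop: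
  assumes "j > 0"
  shows "card {p \<in> dumont132 (2 * m + 1). \<not> has_inc_drop j p} =
    card {p \<in> dumont132 (2 * m). \<not> has_inc_drop j p}"
proof -
  have "{p \<in> dumont132 (2 * m + 1). \<not> has_inc_drop j p} =
      (\<lambda>q. q @ [2 * m + 1]) ` {p \<in> dumont132 (2 * m). \<not> has_inc_drop j p}"
    unfolding dumont132_odd using has_inc_drop_snoc_max[OF cap_bounds(1) assms] by auto
  then show ?thesis by (simp add: card_image inj_on_def)
qed

theorem theorem2p16:
  fixes k :: nat
  assumes "k \<ge> 3"
  shows "dumont_gf ([2..<k + 1] @ [1]) =
           1 + fps_X + fps_X\<^sup>2 * (1 + fps_X) / (1 - fps_X\<^sup>2 - fps_X\<^sup>2 * F (k - 3))"
proof -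
  \<comment> \<open>Then \<open>Suc (Suc j)\<close> is \<open>k - 1\<close>, the length of the run,
    and \<open>j\<close> is the index of \<open>F\<close>.\<close>
  obtain j where k: "k = j + 3" using assms by (metis le_add_diff_inverse2)
  let ?P = "\<lambda>p. \<not> has_inc_drop (Suc (Suc j)) p"
  let ?d = "1 - fps_X\<^sup>2 - fps_X\<^sup>2 * F j"
  have "k \<ge> 1" using assms by simp
  have count: "dumont_count ([2..<k + 1] @ [1]) n = card {p \<in> dumont132 n. ?P p}" for n
    unfolding dumont_count_def dumont132_def avoids_upt_1_iff[OF \<open>k \<ge> 1\<close>]
    by (simp add: k conj_assoc)
  \<comment> \<open>Each odd coefficient equals the even one before it, whence the factor
    \<open>1 + fps_X\<close>.\<close>
  have "dumont_gf ([2..<k + 1] @ [1]) = (1 + fps_X) * even_gf ?P"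
  proof (rule fps_ext)
    fix n
    show "fps_nth (dumont_gf ([2..<k + 1] @ [1])) n = fps_nth ((1 + fps_X) * even_gf ?P) n"
    proof (cases "even n")
      case True
      then show ?thesis
        unfolding dumont_gf_def count
        by (cases n) (simp_all add: distrib_right even_gf_nth)
    next
      case False
      then obtain m where n: "n = 2 * m + 1" by (elim oddE)
      show ?thesis
        unfolding dumont_gf_def count n fps_nth_Abs_fps card_dumont132_odd_no_inc_drop[OF zero_less_Suc]
        by (simp add: distrib_right even_gf_nth)
    qed
  qed
  also have "\<dots> = (1 + fps_X) * (1 + fps_X\<^sup>2 / ?d)"
    unfolding even_gf_no_inc_drop ..
  also have "\<dots> = 1 + fps_X + (1 + fps_X) * (fps_X\<^sup>2 / ?d)"
    by (simp add: distrib_left)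
  also have "(1 + fps_X) * (fps_X\<^sup>2 / ?d) = fps_X\<^sup>2 * (1 + fps_X) / ?d"
    by (simp add: fps_divide_unit mult_ac)
  finally show ?thesis by (simp add: k)
qed

end
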